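(* Let $G = N \times H$ be an isometry group constructed as the direct product of a normal subgroup $N$ and a normal subgroup $H$ whose intersection consists of the neutral element of $G$ only. Then: (a) any indirect isometry of $H$ is an indirect isometry of $G$; (b) any indirect isometry of $N$ is an indirect isometry of $G$.
   Context: An isometry group is a group of isometries of some space; no assumption is made on the space, and the invariance defining its isometries need not come from a true metric, so only the group structure matters. An element of an isometry group $\Gamma$ is called a direct isometry of $\Gamma$ when it can be expressed as a (finite) product of squares of elements of $\Gamma$; otherwise it is called an indirect isometry of $\Gamma$. Thus directness is always relative to a specified group. An element of $N$ or of $H$ is identified with the corresponding element of $G$ ($n$ with $(n,e_H)$, $h$ with $(e_N,h)$). *)

theory Defs
  imports "HOL-Algebra.Coset"
begin

text \<open>
  Isometry groups are rendered as arbitrary groups: the underlying space and the preserved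
  structure are unrestricted, so nothing beyond the group structure is available.  Directness is
  relative to the group record; for a subgroup \<open>H\<close> of \<open>G\<close> it is taken in
  \<open>G\<lparr>carrier := H\<rparr>\<close>.  The empty product causes no deviation from nonempty ones, since the
  neutral element is its own square.
\<close>

definition direct_isometry :: "('a, 'b) monoid_scheme \<Rightarrow> 'a \<Rightarrow> bool" where
  "direct_isometry \<Gamma> x \<longleftrightarrow>
     (\<exists>ys. set ys \<subseteq> carrier \<Gamma> \<and>
        x = foldr (\<otimes>\<^bsub>\<Gamma>\<^esub>) (map (\<lambda>y. y [^]\<^bsub>\<Gamma>\<^esub> (2::nat)) ys) \<one>\<^bsub>\<Gamma>\<^esub>)"

definition indirect_isometry :: "('a, 'b) monoid_scheme \<Rightarrow> 'a \<Rightarrow> bool" where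
  "indirect_isometry \<Gamma> x \<longleftrightarrow> x \<in> carrier \<Gamma> \<and> \<not> direct_isometry \<Gamma> x"

end

theory Submission
  imports Defs
begin

text \<open>
  Modulo \<open>N\<close>, every element of \<open>G = NH\<close> agrees with an element of \<open>H\<close>, so a product of
  squares in \<open>G\<close> is congruent to a product of squares in \<open>H\<close>.  Two congruent elements
  of \<open>H\<close> are equal because \<open>N\<close> and \<open>H\<close> intersect trivially; hence an element of \<open>H\<close>
  that is direct in \<open>G\<close> is direct in \<open>H\<close>.
\<close>

context group
begin

text \<open>Writing \<open>y = n \<otimes> h\<close> with \<open>n\<close> in \<open>N\<close>, the
  left factor \<open>n\<close> is absorbed by the right coset, since
  \<open>N #> n = N\<close>.\<close>

lemma coset_complement_representative:
  assumes "subgroup N G" and "subgroup H G" and "N <#> H = carrier G" and "y \<in> carrier G"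
  obtains h where "h \<in> H" and "N #> y = N #> h"
proof -
  obtain n h where nh: "n \<in> N" "h \<in> H" "y = n \<otimes> h"
    using assms(3,4) unfolding set_mult_def by blast
  then have "N #> y = (N #> n) #> h"
    using assms(1,2) by (simp add: coset_mult_assoc subgroup.subset subgroup.mem_carrier)
  also have "N #> n = N"
    using assms(1) nh(1) by (simp add: coset_join2 subgroup.mem_carrier)
  finally show thesis using nh(2) that by blast
qed

text \<open>Equality of the cosets puts the quotient \<open>h \<otimes> inv k\<close> into
  \<open>N\<close>, and closure of \<open>H\<close> puts it into \<open>H\<close>, so it is
  trivial.\<close>

lemma coset_complement_inj:
  assumes "subgroup N G" and "subgroup H G" and "N \<inter> H = {\<one>}"
    and "h \<in> H" and "k \<in> H" and "N #> h = N #> k"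
  shows "h = k"
proof -
  have c: "h \<in> carrier G" "k \<in> carrier G"
    using assms(2,4,5) by (auto dest: subgroup.mem_carrier)
  have "h \<in> N #> k"
    using rcos_self[OF c(1) assms(1)] assms(6) by simp
  then obtain n where n: "n \<in> N" "h = n \<otimes> k"
    unfolding r_coset_def by auto
  have "n \<in> carrier G"
    using assms(1) n(1) by (rule subgroup.mem_carrier)
  then have "n = h \<otimes> inv k"
    using n(2) c by (simp add: m_assoc)
  then have "n \<in> H"
    using assms(2,4,5) by (simp add: subgroup.m_closed subgroup.m_inv_closed)
  then have "n = \<one>" using n(1) assms(3) by blast
  then show ?thesis using n(2) c by simp
qed

lemma foldr_squares_closed:
  "set ys \<subseteq> carrier G \<Longrightarrow> foldr (\<otimes>) (map (\<lambda>y. y [^] (2::nat)) ys) \<one> \<in> carrier G"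
  by (induction ys) auto

text \<open>Since \<open>N\<close> is normal, the coset of a product is determined by the cosets of
  its factors. Each \<open>y\<close> in the list can therefore be replaced by a representative of
  its coset in \<open>H\<close>.\<close>

lemma coset_foldr_squares_complement:
  assumes "N \<lhd> G" and "subgroup H G" and "N <#> H = carrier G" and "set ys \<subseteq> carrier G"
  shows "\<exists>hs. set hs \<subseteq> H \<and>
           N #> foldr (\<otimes>) (map (\<lambda>y. y [^] (2::nat)) ys) \<one> =
           N #> foldr (\<otimes>) (map (\<lambda>y. y [^] (2::nat)) hs) \<one>"
  using assms(4)
proof (induction ys)
  case Nil
  then show ?case by (intro exI[of _ "[]"]) simp
next
  case (Cons y ys)
  let ?P = "\<lambda>ys. foldr (\<otimes>) (map (\<lambda>y. y [^] (2::nat)) ys) \<one>"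
  from Cons obtain hs where hs: "set hs \<subseteq> H" "N #> ?P ys = N #> ?P hs" by auto
  have y: "y \<in> carrier G" using Cons.prems by simp
  obtain h where h: "h \<in> H" "N #> y = N #> h"
    using coset_complement_representative[OF normal_imp_subgroup[OF assms(1)] assms(2,3) y] .
  have hc: "h \<in> carrier G" using assms(2) h(1) by (rule subgroup.mem_carrier)
  have hsc: "set hs \<subseteq> carrier G" using hs(1) subgroup.subset[OF assms(2)] by blast
  have coset_square: "N #> (x [^] (2::nat)) \<otimes> p = (N #> x) <#> (N #> x) <#> (N #> p)"
    if "x \<in> carrier G" "p \<in> carrier G" for x p
    using that by (simp add: numeral_2_eq_2 normal.rcos_sum[OF assms(1)])
  \<comment> \<open>By \<open>coset_square\<close>, each side becomes a product of three cosets, and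
    these agree factor by factor: \<open>h(2)\<close> for the head, \<open>hs(2)\<close> for the
    tail.\<close>
  have "N #> ?P (y # ys) = N #> ?P (h # hs)"
    using y hc h(2) hs(2) Cons.prems hsc by (simp add: coset_square foldr_squares_closed)
  then show ?case using hs(1) h(1) by (intro exI[of _ "h # hs"]) simp
qed

lemma direct_isometry_complement:
  assumes "N \<lhd> G" and "subgroup H G" and "N \<inter> H = {\<one>}" and "N <#> H = carrier G"
    and "h \<in> H" and "direct_isometry G h"
  shows "direct_isometry (G\<lparr>carrier := H\<rparr>) h"
proof -
  let ?P = "\<lambda>ys. foldr (\<otimes>) (map (\<lambda>y. y [^] (2::nat)) ys) \<one>"
  obtain ys where ys: "set ys \<subseteq> carrier G" "h = ?P ys"
    using assms(6) unfolding direct_isometry_def by blast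
  obtain hs where hs: "set hs \<subseteq> H" "N #> h = N #> ?P hs"
    using coset_foldr_squares_complement[OF assms(1,2,4) ys(1)] ys(2) by blast
  have "?P hs \<in> H"
    \<comment> \<open>Closure is applied in the group with carrier \<open>H\<close>;
      \<open>nat_pow_consistent\<close> identifies its powers with those of
      \<open>G\<close>.\<close>
    using group.foldr_squares_closed[OF subgroup.subgroup_is_group[OF assms(2) is_group], of hs] hs(1)
    by (simp flip: nat_pow_consistent)
  then have "h = ?P hs"
    using coset_complement_inj[OF normal_imp_subgroup[OF assms(1)] assms(2,3,5)] hs(2) by blast
  then show ?thesis
    using hs(1) unfolding direct_isometry_def by (auto simp flip: nat_pow_consistent)
qed

lemma indirect_isometry_complement:
  assumes "N \<lhd> G" and "subgroup H G" and "N \<inter> H = {\<one>}" and "N <#> H = carrier G"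
    and "indirect_isometry (G\<lparr>carrier := H\<rparr>) h"
  shows "indirect_isometry G h"
  using assms direct_isometry_complement[OF assms(1-4)] subgroup.mem_carrier[OF assms(2)]
  unfolding indirect_isometry_def by auto

end

theorem theorem4:
  fixes G :: "('a, 'b) monoid_scheme" and N H :: "'a set"
  assumes "group G"
    and "N \<lhd> G" and "H \<lhd> G"
    and "N \<inter> H = {\<one>\<^bsub>G\<^esub>}"
    and "N <#>\<^bsub>G\<^esub> H = carrier G"
  shows "(\<forall>h. indirect_isometry (G\<lparr>carrier := H\<rparr>) h \<longrightarrow> indirect_isometry G h) \<and>
         (\<forall>n. indirect_isometry (G\<lparr>carrier := N\<rparr>) n \<longrightarrow> indirect_isometry G n)"
proof -
  interpret group G by fact
  have sub: "subgroup N G" "subgroup H G"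
    using assms(2,3) by (simp_all add: normal_imp_subgroup)
  have "H \<inter> N = {\<one>\<^bsub>G\<^esub>}" using assms(4) by blast
  \<comment> \<open>The second half exchanges the roles of \<open>N\<close> and \<open>H\<close>, so
    the factorization is needed in the opposite order; normality lets the two factors be
    swapped.\<close>
  moreover have "H <#>\<^bsub>G\<^esub> N = carrier G"
    using commut_normal[OF sub(2) assms(2)] assms(5) by simp
  ultimately show ?thesis
    using indirect_isometry_complement[OF assms(2) sub(2) assms(4,5)]
      indirect_isometry_complement[OF assms(3) sub(1)] by blast
qed

end
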